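(* Let $\kappa=0$ or $\kappa=-1$, let $V:\mathbb{R}\to\mathbb{R}$ satisfy Assumption (V) of the context, and let $(s,x,w,z)(\tau)$, $\tau\ge0$, be a collapsing scalar field with curvature parameter $\kappa$. If the limit $$\ell:=\lim_{\tau\to+\infty}\big(3w(\tau)^2-\kappa z(\tau)^2\big)$$ exists and is positive, then $t_s\in\mathbb{R}$, i.e. the solution collapses in a finite amount of comoving time. Moreover, if $\ell>1$ then a horizon forms and the model exhibits a black hole; if instead $\ell<1$, then, choosing the boundary $r_b>0$ of the internal solution sufficiently small, the horizon does not form, resulting in a naked singularity.
   Context: **Physical setting.** The interior spacetime is a Robertson--Walker metric $$g=-dt^2+a^2(t)\Big[\frac{dr^2}{1-\kappa r^2}+r^2d\Omega^2\Big],\qquad 0\le r\le r_b,$$ sourced by a homogeneous scalar field $\phi(t)$ with potential $V$ (energy-momentum tensor $T_{\mu\nu}=\phi_{,\mu}\phi_{,\nu}-(\frac12 g^{\alpha\beta}\phi_{,\alpha}\phi_{,\beta}+V(\phi))g_{\mu\nu}$, field equation $G=T$), with $\dot a(0)<0$. Here $t$ is comoving time, a dot is $d/dt$, $h=\dot a/a$. Along $r=r_b$ it is matched (Darmois--Israel conditions) to a generalized Vaidya exterior $ds^2=-(1-2M(U,R)/R)\,dU^2-2\,dR\,dU+R^2d\Omega^2$, with the mass function $M$ continuous across, and $\partial M/\partial U=0$ on, the matching hypersurface. The normalized variables are $x=-\frac1{\sqrt3h}$, $w=-\frac{\dot\phi}{\sqrt6h}$, $z=-\frac1{ha}=-\frac1{\dot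 a}$, and the new time $\tau$ satisfies $d\tau=-\sqrt6\,h\,dt$. Thus $\frac{dt}{d\tau}=\frac{x}{\sqrt2}$, $a=\sqrt3\,x/z$, and $a\to0$ as $\tau\to+\infty$. **Compactification.** $f:\mathbb{R}\to(-1,1)$ is a fixed strictly increasing $C^2$ bijection with $f'>0$, $\lim_{\phi\to-\infty}f''/f'=\lambda_->0$, $\lim_{\phi\to+\infty}f''/f'=\lambda_+<0$; $s=f(\phi)$. Set $u(s)=\frac{V'(f^{-1}(s))}{\sqrt6\,V(f^{-1}(s))}$ wherever $V(f^{-1}(s))\ne0$. **Assumption (V).** $V:\mathbb{R}\to\mathbb{R}$ is of class $C^2$ and: (1) $V(\phi)>0$ for all $|\phi|$ sufficiently large, $V'(\phi)<0$ for all $\phi$ sufficiently close to $-\infty$, and $V'(\phi)>0$ for all $\phi$ sufficiently close to $+\infty$; (2) the limits $u(-1):=\lim_{s\to-1}u(s)$ and $u(1):=\lim_{s\to1}u(s)$ exist and are finite. **Cutoff.** Fix $\delta>0$ such that $V(f^{-1}(s))>0$ and $V'(f^{-1}(s))\ne0$ for all $s\in(-1,-1+\delta)\cup(1-\delta,1)$, and a smooth $\psi:[-1,1]\to[0,1]$ with $\psi(s)=1$ if $|s|\le1-\delta$ and $\psi(s)=0$ if $|s|\in(1-\delta/2,1]$. **Collapsing scalar field with curvature parameter $\kappa\in\{0,-1\}$.** A solution $\tau\mapsto(s,x,w,z)(\tau)$, $\tau\ge0$, of $$\frac{ds}{d\tau}=f'(f^{-1}(s))\,w,\quad \frac{dx}{d\tau}=-\frac{x}{\sqrt6}(3w^2-\kappa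 z^2),\quad \frac{dw}{d\tau}=(1-\psi(s))\theta_1+\psi(s)\theta_2,\quad \frac{dz}{d\tau}=\frac{z}{\sqrt6}(1-3w^2+\kappa z^2),$$ where $$\theta_1=\sqrt{\tfrac32}\Big[w\big(1-w^2+\tfrac\kappa3z^2\big)-u(s)\big(1-w^2+\kappa z^2\big)\Big],\qquad \theta_2=\sqrt{\tfrac32}\,w\big(1-w^2+\tfrac\kappa3z^2\big)-\tfrac12V'(f^{-1}(s))x^2,$$ with initial data satisfying $s(0)\in(-1,1)$, $x(0)>0$, $z(0)>0$ and the (flow-invariant) constraint $V(f^{-1}(s))x^2+w^2-\kappa z^2=1$. (The term $(1-\psi)\theta_1$ is read as $0$ where $\psi=1$.) **Collapse time, horizon, black hole, naked singularity.** The comoving time of collapse is $$t_s=\frac1{\sqrt2}\int_0^\infty x(\tau)\,d\tau\in(0,+\infty].$$ With area radius $R=r\,a(t)$ and Misner--Sharp mass $m$ defined by $1-\frac{2m}{R}=g(\nabla R,\nabla R)$, the apparent horizon is $R=2m$. For a given boundary $r_b>0$, the horizon does not form if $R>2m$ at all $(t,r)$ with $0\le t<t_s$, $0<r\le r_b$; otherwise it forms. The model exhibits a black hole if $t_s<+\infty$ and the horizon forms for every choice of $r_b>0$; the singularity is naked if $t_s<+\infty$ and the horizon does not form for the chosen $r_b$. *)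

theory Defs
  imports "HOL-Analysis.Analysis"
begin

section \<open>Compactification, potential and cutoff\<close>

definition C2 :: "(real \<Rightarrow> real) \<Rightarrow> bool" where
  "C2 g \<longleftrightarrow> (\<forall>y. g differentiable (at y)) \<and> (\<forall>y. deriv g differentiable (at y))
     \<and> continuous_on UNIV (deriv (deriv g))"

definition compactification :: "(real \<Rightarrow> real) \<Rightarrow> bool" where
  "compactification f \<longleftrightarrow>
     C2 f \<and> strict_mono f \<and> bij_betw f UNIV {-1<..<1} \<and> (\<forall>y. deriv f y > 0)
     \<and> (\<exists>l>0. ((\<lambda>y. deriv (deriv f) y / deriv f y) \<longlongrightarrow> l) at_bot)
     \<and> (\<exists>l<0. ((\<lambda>y. deriv (deriv f) y / deriv f y) \<longlongrightarrow> l) at_top)"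

text \<open>Since \<open>f\<close> is a bijection onto the open interval \<open>(-1,1)\<close>, \<open>inv f s\<close> is
  meaningful only for \<open>-1 < s < 1\<close>. The value of \<open>u_fun\<close> is meaningful only where
  \<open>V (inv f s) \<noteq> 0\<close>.\<close>

definition u_fun :: "(real \<Rightarrow> real) \<Rightarrow> (real \<Rightarrow> real) \<Rightarrow> real \<Rightarrow> real" where
  "u_fun f V s = deriv V (inv f s) / (sqrt 6 * V (inv f s))"

definition assumption_V :: "(real \<Rightarrow> real) \<Rightarrow> (real \<Rightarrow> real) \<Rightarrow> bool" where
  "assumption_V f V \<longleftrightarrow>
     C2 V
     \<and> eventually (\<lambda>\<phi>. V \<phi> > 0) at_bot \<and> eventually (\<lambda>\<phi>. V \<phi> > 0) at_top
     \<and> eventually (\<lambda>\<phi>. deriv V \<phi> < 0) at_bot \<and> eventually (\<lambda>\<phi>. deriv V \<phi> > 0) at_top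
     \<and> (\<exists>l. (u_fun f V \<longlongrightarrow> l) (at_right (-1)))
     \<and> (\<exists>l. (u_fun f V \<longlongrightarrow> l) (at_left 1))"

text \<open>Smoothness on a closed interval, with one-sided derivatives of all orders at the
  endpoints: \<open>D n\<close> is the \<open>n\<close>-th derivative.\<close>

definition smooth_on_Icc :: "real \<Rightarrow> real \<Rightarrow> (real \<Rightarrow> real) \<Rightarrow> bool" where
  "smooth_on_Icc a b g \<longleftrightarrow>
     (\<exists>D :: nat \<Rightarrow> real \<Rightarrow> real. (\<forall>s\<in>{a..b}. D 0 s = g s) \<and>
        (\<forall>n. \<forall>s\<in>{a..b}. (D n has_real_derivative D (Suc n) s) (at s within {a..b})))"

definition cutoff ::
  "(real \<Rightarrow> real) \<Rightarrow> (real \<Rightarrow> real) \<Rightarrow> real \<Rightarrow> (real \<Rightarrow> real) \<Rightarrow> bool" where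
  "cutoff f V \<delta> \<psi> \<longleftrightarrow>
     \<delta> > 0
     \<and> (\<forall>s \<in> {-1<..<-1+\<delta>} \<union> {1-\<delta><..<1}. V (inv f s) > 0 \<and> deriv V (inv f s) \<noteq> 0)
     \<and> smooth_on_Icc (-1) 1 \<psi>
     \<and> (\<forall>s\<in>{-1..1}. 0 \<le> \<psi> s \<and> \<psi> s \<le> 1)
     \<and> (\<forall>s\<in>{-1..1}. \<bar>s\<bar> \<le> 1 - \<delta> \<longrightarrow> \<psi> s = 1)
     \<and> (\<forall>s\<in>{-1..1}. 1 - \<delta>/2 < \<bar>s\<bar> \<longrightarrow> \<psi> s = 0)"

section \<open>Collapsing scalar fields\<close>

definition theta1 ::
  "real \<Rightarrow> (real \<Rightarrow> real) \<Rightarrow> (real \<Rightarrow> real) \<Rightarrow> real \<Rightarrow> real \<Rightarrow> real \<Rightarrow> real" where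
  "theta1 \<kappa> f V s w z =
     sqrt (3/2) * (w * (1 - w\<^sup>2 + \<kappa>/3 * z\<^sup>2) - u_fun f V s * (1 - w\<^sup>2 + \<kappa> * z\<^sup>2))"

definition theta2 ::
  "real \<Rightarrow> (real \<Rightarrow> real) \<Rightarrow> (real \<Rightarrow> real) \<Rightarrow> real \<Rightarrow> real \<Rightarrow> real \<Rightarrow> real \<Rightarrow> real" where
  "theta2 \<kappa> f V s x w z =
     sqrt (3/2) * w * (1 - w\<^sup>2 + \<kappa>/3 * z\<^sup>2) - 1/2 * deriv V (inv f s) * x\<^sup>2"

text \<open>Where \<open>V (inv f s) = 0\<close> the cutoff equals 1, so the factor \<open>1 - \<psi> s\<close> removes the
  meaningless value of \<open>u_fun f V s\<close>. The constraint is flow-invariant and is imposed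
  on the initial data.\<close>

definition collapsing_scalar_field ::
  "real \<Rightarrow> (real \<Rightarrow> real) \<Rightarrow> (real \<Rightarrow> real) \<Rightarrow> (real \<Rightarrow> real) \<Rightarrow>
   (real \<Rightarrow> real) \<Rightarrow> (real \<Rightarrow> real) \<Rightarrow> (real \<Rightarrow> real) \<Rightarrow> (real \<Rightarrow> real) \<Rightarrow> bool" where
  "collapsing_scalar_field \<kappa> f V \<psi> s x w z \<longleftrightarrow>
     (\<forall>\<tau>\<ge>0. -1 < s \<tau> \<and> s \<tau> < 1)
     \<and> (\<forall>\<tau>\<ge>0.
          (s has_real_derivative deriv f (inv f (s \<tau>)) * w \<tau>) (at \<tau> within {0..})
        \<and> (x has_real_derivative - (x \<tau> / sqrt 6) * (3 * (w \<tau>)\<^sup>2 - \<kappa> * (z \<tau>)\<^sup>2)) (at \<tau> within {0..})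
        \<and> (w has_real_derivative
             (1 - \<psi> (s \<tau>)) * theta1 \<kappa> f V (s \<tau>) (w \<tau>) (z \<tau>)
             + \<psi> (s \<tau>) * theta2 \<kappa> f V (s \<tau>) (x \<tau>) (w \<tau>) (z \<tau>)) (at \<tau> within {0..})
        \<and> (z has_real_derivative (z \<tau> / sqrt 6) * (1 - 3 * (w \<tau>)\<^sup>2 + \<kappa> * (z \<tau>)\<^sup>2)) (at \<tau> within {0..}))
     \<and> x 0 > 0 \<and> z 0 > 0
     \<and> V (inv f (s 0)) * (x 0)\<^sup>2 + (w 0)\<^sup>2 - \<kappa> * (z 0)\<^sup>2 = 1"

section \<open>Comoving time and scale factor\<close>

text \<open>\<open>x\<close> stays positive along a collapsing scalar field, so no part of the integrand is
  lost in the nonnegative Lebesgue integral below, whose value may be \<open>\<infinity>\<close>.\<close>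

definition collapse_time :: "(real \<Rightarrow> real) \<Rightarrow> ennreal" where
  "collapse_time x = ennreal (1 / sqrt 2) * (\<integral>\<^sup>+ \<tau>\<in>{0..}. ennreal (x \<tau>) \<partial>lborel)"

text \<open>The comoving time \<open>t\<close> at \<open>\<tau>\<close>, from \<open>dt/d\<tau> = x / \<surd>2\<close> with \<open>t = 0\<close> at \<open>\<tau> = 0\<close>.\<close>

definition comoving_time :: "(real \<Rightarrow> real) \<Rightarrow> real \<Rightarrow> real" where
  "comoving_time x \<tau> = 1 / sqrt 2 * integral {0..\<tau>} x"

text \<open>The scale factor \<open>a = \<surd>3 x / z\<close> as a function of comoving time \<open>t\<close>, meaningful
  for \<open>0 \<le> t < t\<^sub>s\<close>.\<close>

definition scale_factor :: "(real \<Rightarrow> real) \<Rightarrow> (real \<Rightarrow> real) \<Rightarrow> real \<Rightarrow> real" where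
  "scale_factor x z t =
     (let \<tau> = the_inv_into {0..} (comoving_time x) t in sqrt 3 * x \<tau> / z \<tau>)"

section \<open>Apparent horizon\<close>

text \<open>\<open>g(\<nabla>F,\<nabla>F)\<close> for the Robertson--Walker metric and a function \<open>F(t,r)\<close> that does not
  depend on the angles. The metric is diagonal with \<open>g\<^sub>t\<^sub>t = -1\<close> and
  \<open>g\<^sub>r\<^sub>r = a\<^sup>2 / (1 - \<kappa> r\<^sup>2)\<close>. The time derivative at \<open>t = 0\<close> is one-sided.\<close>

definition RW_grad_sq ::
  "real \<Rightarrow> (real \<Rightarrow> real) \<Rightarrow> (real \<Rightarrow> real \<Rightarrow> real) \<Rightarrow> real \<Rightarrow> real \<Rightarrow> real" where
  "RW_grad_sq \<kappa> a F t r =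
     (vector_derivative (\<lambda>t'. F t' r) (at t within {0..}))\<^sup>2 / (-1)
     + (deriv (\<lambda>r'. F t r') r)\<^sup>2 / ((a t)\<^sup>2 / (1 - \<kappa> * r\<^sup>2))"

definition area_radius :: "(real \<Rightarrow> real) \<Rightarrow> real \<Rightarrow> real \<Rightarrow> real" where
  "area_radius a t r = r * a t"

text \<open>The mass \<open>m\<close> determined by \<open>1 - 2 m / R = g(\<nabla>R,\<nabla>R)\<close>, where \<open>R > 0\<close>.\<close>

definition misner_sharp_mass :: "real \<Rightarrow> (real \<Rightarrow> real) \<Rightarrow> real \<Rightarrow> real \<Rightarrow> real" where
  "misner_sharp_mass \<kappa> a t r =
     area_radius a t r / 2 * (1 - RW_grad_sq \<kappa> a (area_radius a) t r)"

definition horizon_forms ::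
  "real \<Rightarrow> (real \<Rightarrow> real) \<Rightarrow> (real \<Rightarrow> real) \<Rightarrow> real \<Rightarrow> bool" where
  "horizon_forms \<kappa> x z r\<^sub>b \<longleftrightarrow>
     \<not> (\<forall>t r. 0 \<le> t \<and> ennreal t < collapse_time x \<and> 0 < r \<and> r \<le> r\<^sub>b \<longrightarrow>
          area_radius (scale_factor x z) t r > 2 * misner_sharp_mass \<kappa> (scale_factor x z) t r)"

definition black_hole :: "real \<Rightarrow> (real \<Rightarrow> real) \<Rightarrow> (real \<Rightarrow> real) \<Rightarrow> bool" where
  "black_hole \<kappa> x z \<longleftrightarrow> collapse_time x < \<infinity> \<and> (\<forall>r\<^sub>b>0. horizon_forms \<kappa> x z r\<^sub>b)"

definition naked_singularity ::
  "real \<Rightarrow> (real \<Rightarrow> real) \<Rightarrow> (real \<Rightarrow> real) \<Rightarrow> real \<Rightarrow> bool" where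
  "naked_singularity \<kappa> x z r\<^sub>b \<longleftrightarrow> collapse_time x < \<infinity> \<and> \<not> horizon_forms \<kappa> x z r\<^sub>b"

end

theory Submission
  imports Defs
begin

text \<open>
  Write \<open>p = 3w\<^sup>2 - \<kappa>z\<^sup>2\<close>. Since \<open>x'/x = -p/\<surd>6\<close> and \<open>z'/z = (1 - p)/\<surd>6\<close>, the functions \<open>x\<close> and
  \<open>z\<close> stay positive, the scale factor \<open>\<surd>3 x/z\<close> is a multiple of \<open>exp (-\<tau>/\<surd>6)\<close>, and its derivative
  with respect to comoving time is \<open>-1/z\<close>. Hence \<open>R > 2m\<close> at radius \<open>r\<close> means \<open>r\<^sup>2 (1/z\<^sup>2 + \<kappa>) < 1\<close>.
  If \<open>p \<rightarrow> L > 0\<close>, then comoving time plus a suitable multiple of \<open>x\<close> is eventually decreasing,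
  so comoving time is bounded. If \<open>L > 1\<close>, then \<open>z \<rightarrow> 0\<close> and every boundary radius meets the
  horizon; if \<open>L < 1\<close>, then \<open>z\<close> is eventually increasing, hence bounded away from \<open>0\<close>, and small radii
  avoid it.
\<close>

section \<open>Calculus on half-lines with one-sided derivatives at the endpoint\<close>

lemma DERIV_within_Ici_imp_at:
  fixes g :: "real \<Rightarrow> real"
  assumes "(g has_real_derivative D) (at t within {a..})" "a < t"
  shows "(g has_real_derivative D) (at t)"
  using assms at_within_interior[of t "{a..}"] by simp

lemma nondecreasing_on_Ici:
  fixes g :: "real \<Rightarrow> real"
  assumes deriv: "\<And>t. t \<ge> a \<Longrightarrow> (g has_real_derivative D t) (at t within {a..})"
    and "a \<le> b" "b \<le> c" and nonneg: "\<And>t. b < t \<Longrightarrow> 0 \<le> D t"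
  shows "g b \<le> g c"
proof (rule DERIV_nonneg_imp_increasing_open[OF \<open>b \<le> c\<close>])
  show "continuous_on {b..c} g"
    by (rule continuous_on_subset[OF DERIV_continuous_on[of "{a..}" g D]])
      (use deriv \<open>a \<le> b\<close> in auto)
  show "\<exists>y. DERIV g t :> y \<and> 0 \<le> y" if "b < t" "t < c" for t
    using DERIV_within_Ici_imp_at[OF deriv[of t]] nonneg[of t] that \<open>a \<le> b\<close> by force
qed

lemma DERIV_zero_on_Ici_imp_const:
  fixes g :: "real \<Rightarrow> real"
  assumes "\<And>t. t \<ge> a \<Longrightarrow> (g has_real_derivative 0) (at t within {a..})" and "b \<ge> a"
  shows "g b = g a"
proof -
  obtain c where "\<forall>t\<in>{a..}. g t = c"
    using has_field_derivative_zero_constant[of "{a..}" g] assms(1) by auto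
  with \<open>b \<ge> a\<close> show ?thesis by simp
qed

lemma continuous_on_Ici_primitive:
  fixes g :: "real \<Rightarrow> real"
  assumes "continuous_on {a..} g" "t \<ge> a"
  shows "((\<lambda>t. integral {a..t} g) has_real_derivative g t) (at t within {a..})"
proof -
  have "((\<lambda>t. integral {a..t} g) has_real_derivative g t) (at t within {a..t+1})"
    by (rule integral_has_real_derivative)
      (use assms in \<open>auto intro: continuous_on_subset\<close>)
  \<comment> \<open>Differentiability is local: the cut at \<open>t+1\<close> is invisible near
    \<open>t\<close>, so the compact-interval result transfers to the half-line.\<close>
  moreover have "at t within {a..t+1} = at t within {a..}"
    by (rule at_within_nhd[of _ "{..<t+1}"]) auto
  ultimately show ?thesis by simp
qed

text \<open>Multiplying \<open>y\<close> by the integrating factor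
  \<open>exp (- integral {a..t} g)\<close> gives a constant, so \<open>y\<close> keeps the sign of
  its initial value.\<close>

lemma linear_ode_pos:
  fixes y g :: "real \<Rightarrow> real"
  assumes deriv: "\<And>t. t \<ge> a \<Longrightarrow> (y has_real_derivative y t * g t) (at t within {a..})"
    and cont: "continuous_on {a..} g" and "y a > 0" "t \<ge> a"
  shows "y t > 0"
proof -
  let ?G = "\<lambda>t. integral {a..t} g"
  have "((\<lambda>t. y t * exp (- ?G t)) has_real_derivative 0) (at t within {a..})" if "t \<ge> a" for t
    by (rule derivative_eq_intros deriv continuous_on_Ici_primitive cont that refl)+
      (simp add: algebra_simps)
  from DERIV_zero_on_Ici_imp_const[OF this \<open>t \<ge> a\<close>]
  have "y t * exp (- ?G t) = y a" by simp
  with \<open>y a > 0\<close> show ?thesis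
    by (metis exp_gt_zero zero_less_mult_pos2)
qed

lemma mono_bounded_tendsto_at_top:
  fixes F :: "real \<Rightarrow> real"
  assumes mono: "\<And>b c. a \<le> b \<Longrightarrow> b \<le> c \<Longrightarrow> F b \<le> F c"
    and bound: "\<And>b. a \<le> b \<Longrightarrow> F b \<le> B"
  shows "(F \<longlongrightarrow> Sup (F ` {a..})) at_top"
proof (rule increasing_tendsto)
  have bdd: "bdd_above (F ` {a..})"
    using bound by (auto intro!: bdd_aboveI[of _ B])
  show "\<forall>\<^sub>F t in at_top. F t \<le> Sup (F ` {a..})"
    using eventually_ge_at_top[of a] by eventually_elim (auto intro!: cSUP_upper bdd)
  fix y assume "y < Sup (F ` {a..})"
  then obtain t where "t \<ge> a" "y < F t"
    using less_cSUP_iff[of "{a..}" F y] bdd by auto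
  then show "\<forall>\<^sub>F t in at_top. y < F t"
    unfolding eventually_at_top_linorder
    using mono \<open>t \<ge> a\<close> by (intro exI[of _ t]) (auto intro: less_le_trans)
qed

section \<open>Comoving time and its finite limit\<close>

text \<open>Extending comoving time to negative \<open>\<tau>\<close> makes \<open>t = 0\<close> an interior point, so that the
  two-sided inverse function theorem applies there as well.\<close>

lemma comoving_time_extension:
  assumes cont: "continuous_on {0..} x"
  obtains F where
    "\<And>t. t > -1 \<Longrightarrow> (F has_real_derivative x (max 0 t) / sqrt 2) (at t)"
    "\<And>t. t \<ge> 0 \<Longrightarrow> F t = comoving_time x t"
proof -
  let ?X = "\<lambda>t. x (max 0 t) / sqrt 2"
  \<comment> \<open>The integrand is frozen at its value at 0 for negative times. Subtracting the
    integral over \<open>{-1..0}\<close> normalizes \<open>F 0 = 0\<close>, so that \<open>F\<close>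
    continues comoving time.\<close>
  define F where "F = (\<lambda>t. integral {-1..t} ?X - integral {-1..0} ?X)"
  have contX: "continuous_on A ?X" for A
    by (intro continuous_intros continuous_on_compose2[OF cont]) auto
  have "(F has_real_derivative ?X t) (at t)" if "t > -1" for t
  proof -
    have "((\<lambda>t. integral {-1..t} ?X) has_real_derivative ?X t) (at t)"
      using DERIV_within_Ici_imp_at[OF continuous_on_Ici_primitive[OF contX] that] that by simp
    from DERIV_diff[OF this DERIV_const] show ?thesis
      unfolding F_def by simp
  qed
  moreover have "F t = comoving_time x t" if "t \<ge> 0" for t
  proof -
    have "integral {-1..0} ?X + integral {0..t} ?X = integral {-1..t} ?X"
      by (rule Henstock_Kurzweil_Integration.integral_combine)
        (use that integrable_continuous_real[OF contX] in auto)
    moreover have "integral {0..t} ?X = integral {0..t} (\<lambda>t. x t / sqrt 2)"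
      by (rule integral_cong) auto
    ultimately show ?thesis
      by (simp add: F_def comoving_time_def)
  qed
  ultimately show ?thesis using that by blast
qed

lemma comoving_time_strict_mono:
  assumes cont: "continuous_on {0..} x" and pos: "\<And>t. t \<ge> 0 \<Longrightarrow> x t > 0"
    and "0 \<le> b" "b < c"
  shows "comoving_time x b < comoving_time x c"
proof -
  obtain F where F: "\<And>t. t > -1 \<Longrightarrow> (F has_real_derivative x (max 0 t) / sqrt 2) (at t)"
    "\<And>t. t \<ge> 0 \<Longrightarrow> F t = comoving_time x t"
    using comoving_time_extension[OF cont] by blast
  have "F b < F c"
  proof (rule DERIV_pos_imp_increasing[OF \<open>b < c\<close>])
    fix t assume "b \<le> t"
    then show "\<exists>y. DERIV F t :> y \<and> y > 0"
      using F(1)[of t] pos[of t] \<open>0 \<le> b\<close> by (intro exI[of _ "x t / sqrt 2"]) auto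
  qed
  with F(2) assms(3,4) show ?thesis by simp
qed

text \<open>A bounded increasing comoving time converges to its supremum \<open>T\<close>, which the
  fundamental theorem on \<open>{0..}\<close> identifies with the improper integral. The description
  of the range later turns statements about all comoving times before collapse into statements about
  all \<tau> \<ge> 0.\<close>

lemma collapse_time_bounded:
  assumes cont: "continuous_on {0..} x" and pos: "\<And>t. t \<ge> 0 \<Longrightarrow> x t > 0"
    and bound: "\<And>\<tau>. \<tau> \<ge> 0 \<Longrightarrow> comoving_time x \<tau> \<le> B"
  obtains T where "T > 0" "collapse_time x = ennreal T" "comoving_time x ` {0..} = {0..<T}"
proof -
  obtain F where F: "\<And>t. t > -1 \<Longrightarrow> (F has_real_derivative x (max 0 t) / sqrt 2) (at t)"
    "\<And>t. t \<ge> 0 \<Longrightarrow> F t = comoving_time x t"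
    using comoving_time_extension[OF cont] by blast
  let ?C = "comoving_time x"
  define T where "T = Sup (F ` {0..})"
  have smono: "F b < F c" if "0 \<le> b" "b < c" for b c
    using comoving_time_strict_mono[OF cont pos that] F(2) that by simp
  have lim: "(F \<longlongrightarrow> T) at_top"
    unfolding T_def
    by (rule mono_bounded_tendsto_at_top)
      (use F(2) bound smono in \<open>auto simp: le_less\<close>)
  have C0: "F 0 = 0" using F(2)[of 0] by (simp add: comoving_time_def)
  have less: "F t < T" if "t \<ge> 0" for t
  proof -
    \<comment> \<open>Passing through a later time gives strictness: the supremum is not attained,
      which is why the range is half-open.\<close>
    have "F t < F (t+1)" using smono that by simp
    also have "F (t+1) \<le> T"
      by (rule tendsto_lowerbound[OF lim])
        (use eventually_ge_at_top[of "t+1"] smono that in \<open>auto elim!: eventually_mono simp: le_less\<close>)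
    finally show ?thesis .
  qed
  have contX: "continuous_on UNIV (\<lambda>t. x (max 0 t))"
    by (intro continuous_intros continuous_on_compose2[OF cont]) auto
  have "(\<integral>\<^sup>+ t. ennreal (x (max 0 t) / sqrt 2) * indicator {0..} t \<partial>lborel) = ennreal (T - F 0)"
  proof (rule nn_integral_FTC_atLeast[OF _ _ _ lim])
    show "(\<lambda>t. x (max 0 t) / sqrt 2) \<in> borel_measurable borel"
      using borel_measurable_continuous_onI[OF contX] by measurable
    fix t :: real assume "0 \<le> t"
    then show "DERIV F t :> x (max 0 t) / sqrt 2" "0 \<le> x (max 0 t) / sqrt 2"
      using F(1)[of t] pos[of t] by (simp_all add: less_imp_le)
  qed
  moreover have "(\<integral>\<^sup>+ t. ennreal (x (max 0 t) / sqrt 2) * indicator {0..} t \<partial>lborel)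
    = (\<integral>\<^sup>+ t. ennreal (1 / sqrt 2) * (ennreal (x (max 0 t)) * indicator {0..} t) \<partial>lborel)"
    by (rule nn_integral_cong)
      (use pos in \<open>auto simp: ennreal_mult[symmetric] less_imp_le indicator_def\<close>)
  moreover have "\<dots> = ennreal (1 / sqrt 2) * (\<integral>\<^sup>+ t. ennreal (x (max 0 t)) * indicator {0..} t \<partial>lborel)"
    by (rule nn_integral_cmult) (use borel_measurable_continuous_onI[OF contX] in measurable)
  moreover have "(\<integral>\<^sup>+ t. ennreal (x (max 0 t)) * indicator {0..} t \<partial>lborel)
    = (\<integral>\<^sup>+ t. ennreal (x t) * indicator {0..} t \<partial>lborel)"
    by (rule nn_integral_cong) (auto simp: indicator_def)
  ultimately have "collapse_time x = ennreal T"
    by (simp add: collapse_time_def C0)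
  moreover have "?C ` {0..} = {0..<T}"
  proof (intro set_eqI iffI)
    fix y assume "y \<in> ?C ` {0..}"
    then obtain t where t: "t \<ge> 0" "y = F t" using F(2) by auto
    then have "F 0 \<le> F t" using smono[of 0 t] by (cases "t = 0") auto
    with t less C0 show "y \<in> {0..<T}" by auto
  next
    fix y assume y: "y \<in> {0..<T}"
    obtain t where t: "t \<ge> 0" "y < F t"
      using order_tendstoD(1)[OF lim, of y] y eventually_ge_at_top[of 0]
      by (metis (mono_tags, lifting) atLeastLessThan_iff eventually_conj eventually_happens' trivial_limit_at_top_linorder)
    have "\<exists>b\<ge>0. b \<le> t \<and> F b = y"
    proof (rule IVT')
      show "continuous_on {0..t} F"
        by (intro continuous_at_imp_continuous_on ballI DERIV_isCont[OF F(1)]) auto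
    qed (use t y C0 in auto)
    then show "y \<in> ?C ` {0..}" using F(2) by auto
  qed
  ultimately show ?thesis
    using that less[of 0] C0 by simp
qed

section \<open>Positivity and the scale factor of curves driven by \<open>p\<close>\<close>

locale collapse_curves =
  fixes p x z :: "real \<Rightarrow> real"
  assumes cont_p: "continuous_on {0..} p"
    and deriv_x: "\<And>t. t \<ge> 0 \<Longrightarrow> (x has_real_derivative - (x t / sqrt 6) * p t) (at t within {0..})"
    and deriv_z: "\<And>t. t \<ge> 0 \<Longrightarrow> (z has_real_derivative z t / sqrt 6 * (1 - p t)) (at t within {0..})"
    and x0: "x 0 > 0" and z0: "z 0 > 0"
begin

lemma x_pos: "t \<ge> 0 \<Longrightarrow> x t > 0"
  by (rule linear_ode_pos[of 0 x "\<lambda>t. - p t / sqrt 6"])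
    (use deriv_x x0 cont_p in \<open>auto intro!: continuous_intros\<close>)

lemma z_pos: "t \<ge> 0 \<Longrightarrow> z t > 0"
  by (rule linear_ode_pos[of 0 z "\<lambda>t. (1 - p t) / sqrt 6"])
    (use deriv_z z0 cont_p in \<open>auto intro!: continuous_intros\<close>)

lemma cont_x: "continuous_on {0..} x"
  by (rule DERIV_continuous_on[of _ _ "\<lambda>t. - (x t / sqrt 6) * p t"]) (use deriv_x in auto)

lemma cont_z: "continuous_on {0..} z"
  by (rule DERIV_continuous_on[of _ _ "\<lambda>t. z t / sqrt 6 * (1 - p t)"]) (use deriv_z in auto)

text \<open>The coefficient \<open>p\<close> cancels in the logarithmic derivative: x'/x - z'/z =
  -p/sqrt 6 - (1 - p)/sqrt 6 = -1/sqrt 6.\<close>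

lemma ratio_eq:
  assumes "\<tau> \<ge> 0"
  shows "x \<tau> / z \<tau> = x 0 / z 0 * exp (- \<tau> / sqrt 6)"
proof -
  have "((\<lambda>\<tau>. x \<tau> / z \<tau> * exp (\<tau> / sqrt 6)) has_real_derivative 0) (at t within {0..})"
    if "t \<ge> 0" for t
  proof -
    have "z t \<noteq> 0" using z_pos[OF that] by simp
    then show ?thesis
      by - (rule derivative_eq_intros deriv_x deriv_z that refl | assumption | simp add: field_simps)+
  qed
  from DERIV_zero_on_Ici_imp_const[OF this assms]
  have "x \<tau> / z \<tau> * exp (\<tau> / sqrt 6) = x 0 / z 0" by simp
  moreover have "exp (\<tau> / sqrt 6) * exp (- \<tau> / sqrt 6) = 1"
    by (simp flip: exp_add)
  ultimately show ?thesis
    by (metis mult.assoc mult.right_neutral)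
qed

lemma inj_comoving_time: "inj_on (comoving_time x) {0..}"
  by (rule linorder_inj_onI) (use comoving_time_strict_mono[OF cont_x x_pos] in force)+

lemma scale_factor_comoving_time:
  assumes "\<tau> \<ge> 0"
  shows "scale_factor x z (comoving_time x \<tau>) = sqrt 3 * x \<tau> / z \<tau>"
  using assms by (simp add: scale_factor_def the_inv_into_f_f[OF inj_comoving_time])

text \<open>By the chain rule, da/dt = (da/d\<tau>) / (dt/d\<tau>) = (-a/sqrt 6) / (x/sqrt 2) =
  -a/(sqrt 3 x), which is -1/z because a = sqrt 3 x/z.\<close>

lemma scale_factor_deriv:
  assumes img: "comoving_time x ` {0..} = {0..<T}" and \<tau>: "\<tau> \<ge> 0"
  shows "(scale_factor x z has_real_derivative - 1 / z \<tau>) (at (comoving_time x \<tau>) within {0..})"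
proof -
  obtain F where F: "\<And>t. t > -1 \<Longrightarrow> (F has_real_derivative x (max 0 t) / sqrt 2) (at t)"
    "\<And>t. t \<ge> 0 \<Longrightarrow> F t = comoving_time x t"
    using comoving_time_extension[OF cont_x] by blast
  have smono: "F b < F c" if "-1 < b" "b < c" for b c
  proof (rule DERIV_pos_imp_increasing[OF \<open>b < c\<close>])
    fix t assume "b \<le> t"
    then show "\<exists>y. DERIV F t :> y \<and> y > 0"
      using F(1)[of t] x_pos[of "max 0 t"] \<open>-1 < b\<close>
      by (intro exI[of _ "x (max 0 t) / sqrt 2"]) auto
  qed
  have inj: "inj_on F {-1<..}"
    by (rule linorder_inj_onI) (use smono in force)+
  define G where "G = the_inv_into {-1<..} F"
  have GF: "G (F t) = t" if "t > -1" for t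
    using that by (simp add: G_def the_inv_into_f_f[OF inj])
  define A where "A = sqrt 3 * x 0 / z 0"
  \<comment> \<open>This is the exponential form of the scale factor composed with the inverse
    \<open>G\<close> of the extended time. It is differentiable from both sides even at comoving
    time 0.\<close>
  define a where "a = (\<lambda>t. A * exp (- G t / sqrt 6))"
  have "(G has_derivative (*) (inverse (x \<tau> / sqrt 2))) (at (F \<tau>))"
  proof (rule has_derivative_inverse_strong[of "{-1<..}" \<tau> F G "(*) (x \<tau> / sqrt 2)"])
    show "continuous_on {-1<..} F"
      by (rule has_real_derivative_imp_continuous_on) (use F(1) in auto)
    show "(F has_derivative (*) (x \<tau> / sqrt 2)) (at \<tau>)"
      using F(1)[of \<tau>] \<tau> by (simp add: has_field_derivative_def)
    show "(*) (x \<tau> / sqrt 2) \<circ> (*) (inverse (x \<tau> / sqrt 2)) = id"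
      using x_pos[OF \<tau>] by (auto simp: fun_eq_iff)
  qed (use GF \<tau> in auto)
  then have dG: "(G has_real_derivative inverse (x \<tau> / sqrt 2)) (at (F \<tau>))"
    by (simp add: has_field_derivative_def)
  have scale: "scale_factor x z (F t) = a (F t)" if "t \<ge> 0" for t
  proof -
    have "scale_factor x z (F t) = sqrt 3 * (x t / z t)"
      using scale_factor_comoving_time[OF that] F(2)[OF that] by simp
    also have "\<dots> = a (F t)"
      using GF[of t] that by (simp only: ratio_eq[OF that]) (simp add: a_def A_def)
    finally show ?thesis .
  qed
  have "sqrt 6 = sqrt 2 * sqrt 3"
    by (simp flip: real_sqrt_mult)
  moreover have "a (F \<tau>) = sqrt 3 * x \<tau> / z \<tau>"
    using scale[OF \<tau>] scale_factor_comoving_time[OF \<tau>] F(2)[OF \<tau>] by simp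
  ultimately have "- a (F \<tau>) * (inverse (x \<tau> / sqrt 2) / sqrt 6) = - 1 / z \<tau>"
    using x_pos[OF \<tau>] by (simp add: field_simps)
  moreover have "(a has_real_derivative - a (F \<tau>) * (inverse (x \<tau> / sqrt 2) / sqrt 6)) (at (F \<tau>))"
    using DERIV_cmult[OF DERIV_fun_exp[OF DERIV_cdivide[OF DERIV_minus[OF dG]]], of A "sqrt 6"]
    by (simp add: a_def mult.assoc)
  ultimately have "(a has_real_derivative - 1 / z \<tau>) (at (F \<tau>))"
    by (simp only:)
  then have da: "(a has_real_derivative - 1 / z \<tau>) (at (F \<tau>) within {0..})"
    by (rule has_field_derivative_at_within)
  have F\<tau>: "F \<tau> \<in> {0..<T}" using img F(2)[OF \<tau>] \<tau> by auto
  have "(scale_factor x z has_real_derivative - 1 / z \<tau>) (at (F \<tau>) within {0..})"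
  proof (rule has_field_derivative_transform_within[OF da])
    \<comment> \<open>Agreement of \<open>a\<close> with \<open>scale_factor x z\<close> is
      available only on \<open>{0..<T}\<close>, where comoving time has a preimage; this radius
      keeps the neighbourhood inside that range.\<close>
    show "0 < T - F \<tau>" "F \<tau> \<in> {0..}" using F\<tau> by auto
    fix t assume "t \<in> {0..}" "dist t (F \<tau>) < T - F \<tau>"
    then have "t \<in> {0..<T}" by (auto simp: dist_real_def)
    then obtain b where "b \<ge> 0" "t = F b" using img F(2) by (metis atLeast_iff imageE)
    then show "a t = scale_factor x z t" using scale by simp
  qed
  then show ?thesis using F(2)[OF \<tau>] by simp
qed

section \<open>The apparent horizon in terms of \<open>z\<close>\<close>

text \<open>For R = r a the squared gradient is N = -r^2 (da/dt)^2 + 1 - \<kappa> r^2 with da/dt =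
  -1/z, and R - 2m = R N. Since R > 0, only the sign of N matters.\<close>

lemma outside_horizon_iff:
  assumes img: "comoving_time x ` {0..} = {0..<T}" and \<tau>: "\<tau> \<ge> 0" and "r > 0"
  shows "area_radius (scale_factor x z) (comoving_time x \<tau>) r
      > 2 * misner_sharp_mass \<kappa> (scale_factor x z) (comoving_time x \<tau>) r
    \<longleftrightarrow> r\<^sup>2 * (1 / (z \<tau>)\<^sup>2 + \<kappa>) < 1"
proof -
  let ?t = "comoving_time x \<tau>" and ?a = "scale_factor x z"
  define N where "N = RW_grad_sq \<kappa> ?a (area_radius ?a) ?t r"
  have a_pos: "?a ?t > 0"
    using scale_factor_comoving_time[OF \<tau>] x_pos[OF \<tau>] z_pos[OF \<tau>] by simp
  have "((\<lambda>t'. r * ?a t') has_real_derivative r * (- 1 / z \<tau>)) (at ?t within {0..})"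
    by (rule DERIV_cmult[OF scale_factor_deriv[OF img \<tau>]])
  moreover have "?t \<ge> 0" using img \<tau> by auto
  \<comment> \<open>The filter must be nontrivial for the one-sided derivative to be unique;
    approach from the right works also at comoving time 0.\<close>
  moreover have "at ?t within {0..} \<noteq> bot"
  proof -
    have "at_right ?t \<le> at ?t within {0..}"
      by (rule at_le) (use \<open>?t \<ge> 0\<close> in auto)
    then show ?thesis
      using trivial_limit_at_right_real[of ?t] by (metis bot.extremum_uniqueI)
  qed
  ultimately have "vector_derivative (\<lambda>t'. r * ?a t') (at ?t within {0..}) = r * (- 1 / z \<tau>)"
    by (intro vector_derivative_within)
      (auto simp: has_real_derivative_iff_has_vector_derivative)
  moreover have "deriv (\<lambda>r'. r' * ?a ?t) r = ?a ?t"
    by (rule DERIV_imp_deriv) (auto intro!: derivative_eq_intros)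
  moreover have "(?a ?t)\<^sup>2 / ((?a ?t)\<^sup>2 / (1 - \<kappa> * r\<^sup>2)) = 1 - \<kappa> * r\<^sup>2"
    using a_pos by simp
  ultimately have "N = (r * (- 1 / z \<tau>))\<^sup>2 / (-1) + (1 - \<kappa> * r\<^sup>2)"
    unfolding N_def RW_grad_sq_def area_radius_def by presburger
  then have N: "N = 1 - r\<^sup>2 * (1 / (z \<tau>)\<^sup>2 + \<kappa>)"
    by (simp add: power_mult_distrib power_divide algebra_simps)
  have "area_radius ?a ?t r - 2 * misner_sharp_mass \<kappa> ?a ?t r = r * ?a ?t * N"
    by (simp add: misner_sharp_mass_def N_def area_radius_def algebra_simps)
  moreover have "r * ?a ?t * N > 0 \<longleftrightarrow> N > 0"
    using mult_pos_pos[OF \<open>r > 0\<close> a_pos] by (metis mult_pos_pos zero_less_mult_pos)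
  ultimately show ?thesis using N by linarith
qed

lemma horizon_forms_iff:
  assumes img: "comoving_time x ` {0..} = {0..<T}" and T: "collapse_time x = ennreal T"
  shows "horizon_forms \<kappa> x z r\<^sub>b
    \<longleftrightarrow> (\<exists>\<tau>\<ge>0. \<exists>r>0. r \<le> r\<^sub>b \<and> 1 \<le> r\<^sup>2 * (1 / (z \<tau>)\<^sup>2 + \<kappa>))"
proof -
  have "0 \<le> t \<and> ennreal t < collapse_time x \<longleftrightarrow> (\<exists>\<tau>\<ge>0. t = comoving_time x \<tau>)" for t
  proof -
    have "0 \<le> t \<and> ennreal t < collapse_time x \<longleftrightarrow> t \<in> {0..<T}"
      by (auto simp: T ennreal_less_iff)
    also have "\<dots> \<longleftrightarrow> (\<exists>\<tau>\<ge>0. t = comoving_time x \<tau>)"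
      unfolding img[symmetric] by auto
    finally show ?thesis .
  qed
  then show ?thesis
    unfolding horizon_forms_def
    by (smt (verit) outside_horizon_iff[OF img])
qed

section \<open>Consequences of the limit of \<open>p\<close> for comoving time and
  \<open>z\<close>\<close>

lemma comoving_time_bound:
  assumes lim: "(p \<longlongrightarrow> L) at_top" and "L > 0"
  obtains B where "\<And>\<tau>. \<tau> \<ge> 0 \<Longrightarrow> comoving_time x \<tau> \<le> B"
proof -
  obtain b where b: "b \<ge> 0" "\<And>t. t \<ge> b \<Longrightarrow> p t > L / 2"
    using order_tendstoD(1)[OF lim, of "L / 2"] \<open>L > 0\<close>
    by (auto simp: eventually_at_top_linorder)
      (metis linorder_le_cases order_trans)
  \<comment> \<open>This choice makes the derivative of comoving time plus \<open>K * x\<close>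
    equal to (x/sqrt 2) (1 - 2p/L), which is negative once p > L/2. Below, \<open>?g\<close> is the
    negative of this sum, to fit the monotonicity lemma.\<close>
  define K where "K = 2 * sqrt 6 / (L * sqrt 2)"
  have K: "K > 0" using \<open>L > 0\<close> by (simp add: K_def)
  let ?g = "\<lambda>t. - (1 / sqrt 2 * integral {0..t} x + K * x t)"
  let ?D = "\<lambda>t. x t / sqrt 2 * (2 * p t / L - 1)"
  have D: "(?g has_real_derivative ?D t) (at t within {0..})" if "t \<ge> 0" for t
    by (rule derivative_eq_intros deriv_x continuous_on_Ici_primitive cont_x that refl)+
      (use \<open>L > 0\<close> in \<open>simp add: K_def field_simps\<close>)
  have late: "comoving_time x \<tau> \<le> comoving_time x b + K * x b" if "\<tau> \<ge> b" for \<tau>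
  proof -
    have "?g b \<le> ?g \<tau>"
    proof (rule nondecreasing_on_Ici[OF D \<open>b \<ge> 0\<close> that])
      fix t assume "b < t"
      then show "0 \<le> ?D t"
        using b(2)[of t] b(1) x_pos[of t] \<open>L > 0\<close>
        by (intro mult_nonneg_nonneg) (auto simp: field_simps)
    qed auto
    moreover have "K * x \<tau> > 0" using x_pos[of \<tau>] that b(1) K by simp
    ultimately show ?thesis by (simp add: comoving_time_def)
  qed
  have "comoving_time x \<tau> \<le> comoving_time x b + K * x b" if "\<tau> \<ge> 0" for \<tau>
  proof (cases "\<tau> < b")
    case True
    have "K * x b > 0" using x_pos b(1) K by simp
    with comoving_time_strict_mono[OF cont_x x_pos that True] show ?thesis by simp
  qed (use late in simp)
  then show ?thesis by (rule that)
qed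

text \<open>Once p < 1, the derivative z (1 - p)/sqrt 6 is positive, so from some time
  \<open>b\<close> on \<open>z\<close> does not fall below \<open>z b\<close>. On the compact
  interval before that, \<open>z\<close> attains a positive minimum, which then bounds the whole
  curve.\<close>

lemma z_bounded_below:
  assumes lim: "(p \<longlongrightarrow> L) at_top" and "L < 1"
  obtains c where "c > 0" "\<And>\<tau>. \<tau> \<ge> 0 \<Longrightarrow> z \<tau> \<ge> c"
proof -
  obtain b where b: "b \<ge> 0" "\<And>t. t \<ge> b \<Longrightarrow> p t < 1"
    using order_tendstoD(2)[OF lim, of 1] \<open>L < 1\<close>
    by (auto simp: eventually_at_top_linorder)
      (metis linorder_le_cases order_trans)
  obtain m where m: "m \<in> {0..b}" "\<And>t. t \<in> {0..b} \<Longrightarrow> z m \<le> z t"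
    using continuous_attains_inf[of "{0..b}" z] continuous_on_subset[OF cont_z] b(1) by force
  have "z m \<le> z \<tau>" if "\<tau> \<ge> 0" for \<tau>
  proof (cases "\<tau> \<le> b")
    case False
    have "z b \<le> z \<tau>"
      by (rule nondecreasing_on_Ici[OF deriv_z b(1)])
        (use False b z_pos in \<open>auto simp: less_imp_le\<close>)
    with m(2)[of b] b(1) show ?thesis by simp
  qed (use m that in auto)
  with that[of "z m"] z_pos m show ?thesis by simp
qed

text \<open>If \<open>z\<close> stayed above \<epsilon> while p - 1 is eventually bounded below by a
  positive \<open>q\<close>, then \<open>z\<close> would decrease at least linearly and lose its
  positivity.\<close>

lemma z_small:
  assumes lim: "(p \<longlongrightarrow> L) at_top" and "L > 1" and "\<epsilon> > 0"
  obtains \<tau> where "\<tau> \<ge> 0" "z \<tau> < \<epsilon>"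
proof (rule ccontr)
  assume "\<not> thesis"
  with that have big: "z t \<ge> \<epsilon>" if "t \<ge> 0" for t using not_less \<open>t \<ge> 0\<close> by blast
  define q where "q = (L - 1) / 2"
  have q: "q > 0" using \<open>L > 1\<close> by (simp add: q_def)
  have "1 + q < L" using \<open>L > 1\<close> by (simp add: q_def field_simps)
  then obtain b where b: "b \<ge> 0" "\<And>t. t \<ge> b \<Longrightarrow> p t > 1 + q"
    using order_tendstoD(1)[OF lim, of "1 + q"]
    by (auto simp: eventually_at_top_linorder)
      (metis linorder_le_cases order_trans)
  define k where "k = \<epsilon> * q / sqrt 6"
  have k: "k > 0" using q \<open>\<epsilon> > 0\<close> by (simp add: k_def)
  \<comment> \<open>The line through (\<open>b\<close>, \<open>z b\<close>) with slope
    \<open>-k\<close> reaches zero at \<open>?c\<close>, and \<open>z\<close> lies on or below that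
    line after \<open>b\<close>.\<close>
  let ?c = "b + z b / k"
  let ?D = "\<lambda>t. z t / sqrt 6 * (p t - 1) - k"
  have zb: "z b > 0" using z_pos b by simp
  have "- z b - k * b \<le> - z ?c - k * ?c"
  proof (rule nondecreasing_on_Ici[where g = "\<lambda>t. - z t - k * t" and D = ?D and a = 0])
    show "((\<lambda>t. - z t - k * t) has_real_derivative ?D t) (at t within {0..})" if "t \<ge> 0" for t
      by (rule derivative_eq_intros deriv_z that refl)+ (simp add: field_simps)
    fix t assume "b < t"
    then have "\<epsilon> * q \<le> z t * (p t - 1)"
      using b(2)[of t] b(1) big[of t] q \<open>\<epsilon> > 0\<close> by (intro mult_mono) auto
    then show "0 \<le> ?D t" by (simp add: k_def divide_right_mono)
  qed (use b zb k in auto)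
  moreover have "k * ?c = k * b + z b" using k by (simp add: field_simps)
  ultimately have "z ?c \<le> 0" by linarith
  moreover have "z ?c > 0" using z_pos[of ?c] b(1) zb k by simp
  ultimately show False by simp
qed

end

theorem proposition5p1:
  fixes \<kappa> \<delta> L :: real
    and f V \<psi> s x w z :: "real \<Rightarrow> real"
  assumes "\<kappa> = 0 \<or> \<kappa> = -1"
    and "compactification f"
    and "assumption_V f V"
    and "cutoff f V \<delta> \<psi>"
    and "collapsing_scalar_field \<kappa> f V \<psi> s x w z"
    and "((\<lambda>\<tau>. 3 * (w \<tau>)\<^sup>2 - \<kappa> * (z \<tau>)\<^sup>2) \<longlongrightarrow> L) at_top"
    and "L > 0"
  shows "collapse_time x < \<infinity>
    \<and> (L > 1 \<longrightarrow> black_hole \<kappa> x z)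
    \<and> (L < 1 \<longrightarrow> (\<exists>r\<^sub>0>0. \<forall>r\<^sub>b. 0 < r\<^sub>b \<and> r\<^sub>b \<le> r\<^sub>0 \<longrightarrow> naked_singularity \<kappa> x z r\<^sub>b))"
proof -
  define p where "p = (\<lambda>\<tau>. 3 * (w \<tau>)\<^sup>2 - \<kappa> * (z \<tau>)\<^sup>2)"
  note field = assms(5)[unfolded collapsing_scalar_field_def]
  have "continuous_on {0..} w"
    by (rule DERIV_continuous_on) (use field in auto)
  moreover have "continuous_on {0..} z"
    by (rule DERIV_continuous_on) (use field in auto)
  ultimately have cont: "continuous_on {0..} p"
    unfolding p_def by (intro continuous_intros)
  \<comment> \<open>With \<open>p\<close> as a given continuous coefficient, the equations for
    \<open>x\<close> and \<open>z\<close> are linear and decoupled.\<close>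
  interpret collapse_curves p x z
    using cont field by unfold_locales (simp_all add: p_def algebra_simps)
  have lim: "(p \<longlongrightarrow> L) at_top" using assms(6) by (simp add: p_def)
  obtain B where "\<And>\<tau>. \<tau> \<ge> 0 \<Longrightarrow> comoving_time x \<tau> \<le> B"
    using comoving_time_bound[OF lim \<open>L > 0\<close>] by blast
  then obtain T where T: "collapse_time x = ennreal T" "comoving_time x ` {0..} = {0..<T}"
    using collapse_time_bounded[OF cont_x x_pos] by metis
  note horizon = horizon_forms_iff[OF T(2,1)]
  have finite: "collapse_time x < \<infinity>" by (simp add: T(1))
  have "horizon_forms \<kappa> x z r" if "L > 1" "r > 0" for r
  proof -
    \<comment> \<open>This threshold solves r^2 (1/z^2 - 1) = 1, the horizon condition for \<kappa>
      = -1. For \<kappa> = 0 the left side is only larger, so one threshold serves both cases, and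
      the boundary radius itself meets the horizon.\<close>
    have "1 / sqrt (1 / r\<^sup>2 + 1) > 0"
      using \<open>r > 0\<close> by (simp add: add_pos_pos)
    then obtain \<tau> where \<tau>: "\<tau> \<ge> 0" "z \<tau> < 1 / sqrt (1 / r\<^sup>2 + 1)"
      using z_small[OF lim \<open>L > 1\<close>] by blast
    have "z \<tau> > 0" using z_pos \<tau>(1) .
    have "sqrt (1 / r\<^sup>2 + 1) < 1 / z \<tau>"
      using \<tau>(2) \<open>z \<tau> > 0\<close> \<open>r > 0\<close> by (simp add: field_simps add_pos_pos)
    then have "1 / r\<^sup>2 + 1 < (1 / z \<tau>)\<^sup>2"
      using power_strict_mono[of "sqrt (1 / r\<^sup>2 + 1)" "1 / z \<tau>" 2] by simp
    then have "1 / r\<^sup>2 \<le> 1 / (z \<tau>)\<^sup>2 + \<kappa>"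
      using assms(1) by (auto simp: power_divide)
    then have "1 \<le> r\<^sup>2 * (1 / (z \<tau>)\<^sup>2 + \<kappa>)"
      using \<open>r > 0\<close> by (metis mult.commute pos_divide_le_eq zero_less_power)
    then show ?thesis using horizon \<tau>(1) \<open>r > 0\<close> by auto
  qed
  moreover have "\<exists>r\<^sub>0>0. \<forall>r\<^sub>b. 0 < r\<^sub>b \<and> r\<^sub>b \<le> r\<^sub>0 \<longrightarrow> \<not> horizon_forms \<kappa> x z r\<^sub>b" if "L < 1"
  proof -
    obtain c where c: "c > 0" "\<And>\<tau>. \<tau> \<ge> 0 \<Longrightarrow> z \<tau> \<ge> c"
      using z_bounded_below[OF lim \<open>L < 1\<close>] by blast
    have "r\<^sup>2 * (1 / (z \<tau>)\<^sup>2 + \<kappa>) < 1" if "\<tau> \<ge> 0" "0 < r" "r \<le> c / 2" for \<tau> r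
    proof -
      have "r\<^sup>2 * (1 / (z \<tau>)\<^sup>2 + \<kappa>) \<le> r\<^sup>2 * (1 / (z \<tau>)\<^sup>2)"
        using assms(1) by (intro mult_left_mono) auto
      also have "\<dots> = (r / z \<tau>)\<^sup>2" by (simp add: power_divide)
      also have "\<dots> < 1"
        using c(1) c(2)[OF that(1)] that(2,3) by (intro power_less_one_iff[THEN iffD2]) auto
      finally show ?thesis .
    qed
    then have "\<not> horizon_forms \<kappa> x z r\<^sub>b" if "r\<^sub>b \<le> c / 2" for r\<^sub>b
      unfolding horizon using that by (meson not_le order_trans)
    then show ?thesis using c(1) by (intro exI[of _ "c / 2"]) auto
  qed
  ultimately show ?thesis
    using finite by (simp add: black_hole_def naked_singularity_def)
qed

end
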